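(* Let $I \subseteq \mathbb{R}$ be an open interval. (1) If $s : I \to \mathbb{R}$ is a nowhere-zero solution to $\mathbf{PII}_0$ on $I$, then $s^2$ is a solution to $\mathbf{XX}$ on $I$. (2) If $S : I \to \mathbb{R}$ is a strictly positive solution to $\mathbf{XX}$ on $I$, then its positive square-root $\sqrt{S}$ is a solution to $\mathbf{PII}_0$ on $I$.
   Context: Everything is real: $t$ is a real variable and solutions are real-valued. The homogeneous second Painlevé equation $\mathbf{PII}_0$ is $$s'' = 2 s^3 + t s;$$ a solution on an open interval $I$ is a twice-differentiable function $s : I \to \mathbb{R}$ with $s''(t) = 2s(t)^3 + t s(t)$ for all $t \in I$. Equation $\mathbf{XX}$ is $$S'' = \frac{(S')^2}{2S} + 4 S^2 + 2 t S;$$ a nowhere-zero function $S : I \to \mathbb{R}$ is a solution to $\mathbf{XX}$ on $I$ if it is twice differentiable and $S''(t) = \frac{S'(t)^2}{2S(t)} + 4S(t)^2 + 2tS(t)$ for all $t \in I$. *)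

theory Defs
  imports "HOL-Analysis.Analysis"
begin

text \<open>
  A function on \<open>I\<close> is represented by a total function on the reals of which only the values on
  \<open>I\<close> matter. The definitions below are meant for open \<open>I\<close>: there \<^const>\<open>deriv\<close> is, at each point
  of \<open>I\<close>, determined by the restriction to \<open>I\<close>, and differentiability within \<open>I\<close> is ordinary
  differentiability.
\<close>

definition twice_differentiable_on :: "(real \<Rightarrow> real) \<Rightarrow> real set \<Rightarrow> bool" where
  "twice_differentiable_on f I \<longleftrightarrow> f differentiable_on I \<and> deriv f differentiable_on I"

definition solves_PII0_on :: "(real \<Rightarrow> real) \<Rightarrow> real set \<Rightarrow> bool" where
  "solves_PII0_on s I \<longleftrightarrow>
     twice_differentiable_on s I \<and>
     (\<forall>t\<in>I. deriv (deriv s) t = 2 * s t ^ 3 + t * s t)"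

definition solves_XX_on :: "(real \<Rightarrow> real) \<Rightarrow> real set \<Rightarrow> bool" where
  "solves_XX_on S I \<longleftrightarrow>
     (\<forall>t\<in>I. S t \<noteq> 0) \<and>
     twice_differentiable_on S I \<and>
     (\<forall>t\<in>I. deriv (deriv S) t = (deriv S t)\<^sup>2 / (2 * S t) + 4 * (S t)\<^sup>2 + 2 * t * S t)"

end

theory Submission
  imports Defs
begin

text \<open>
  The two equations are related by the substitution \<open>S = s\<^sup>2\<close>. Where \<open>s \<noteq> 0\<close>, differentiating
  gives \<open>S' = 2 s s'\<close>, hence \<open>(S')\<^sup>2 / (2 S) = 2 (s')\<^sup>2\<close>, and differentiating once more gives
  \<open>S'' = 2 (s')\<^sup>2 + 2 s s'' = (S')\<^sup>2 / (2 S) + 2 s s''\<close>.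
  The remaining terms \<open>4 S\<^sup>2 + 2 t S\<close> of the equation for \<open>S\<close> are \<open>2 s (2 s\<^sup>3 + t s)\<close>, so that
  equation is the one for \<open>s\<close> multiplied by the nonvanishing factor \<open>2 s\<close>. When \<open>S > 0\<close> is given,
  \<open>s = \<surd>S\<close> inherits its differentiability from the smoothness of the square root on the positive
  half-line.

  Both directions compute with explicit derivatives. The passage between these and iterated
  \<^const>\<open>deriv\<close> on an open set is \<open>twice_differentiable_onD\<close> and
  \<open>twice_differentiable_on_derivs\<close>.
\<close>

lemma twice_differentiable_onD:
  assumes "open I" and "twice_differentiable_on f I" and "t \<in> I"
  shows "(f has_real_derivative deriv f t) (at t)"
    and "(deriv f has_real_derivative deriv (deriv f) t) (at t)"
  using assms
  by (auto simp: twice_differentiable_on_def differentiable_on_eq_differentiable_at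
        DERIV_deriv_iff_real_differentiable)

text \<open>
  Openness is what makes the second derivative work: \<open>deriv f\<close> agrees with \<open>f'\<close> on a whole
  neighbourhood of each point of \<open>I\<close>, so the two functions have the same derivative there.
\<close>
lemma twice_differentiable_on_derivs:
  fixes f f' f'' :: "real \<Rightarrow> real"
  assumes I: "open I"
    and f: "\<And>t. t \<in> I \<Longrightarrow> (f has_real_derivative f' t) (at t)"
    and f': "\<And>t. t \<in> I \<Longrightarrow> (f' has_real_derivative f'' t) (at t)"
  shows "twice_differentiable_on f I"
    and "\<And>t. t \<in> I \<Longrightarrow> deriv f t = f' t"
    and "\<And>t. t \<in> I \<Longrightarrow> deriv (deriv f) t = f'' t"
proof -
  show deriv_f: "deriv f t = f' t" if "t \<in> I" for t
    using f[OF that] by (rule DERIV_imp_deriv)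
  have deriv_f': "(deriv f has_real_derivative f'' t) (at t)" if "t \<in> I" for t
    using f'[OF that] I that by (rule has_field_derivative_transform_within_open) (simp add: deriv_f)
  then show "deriv (deriv f) t = f'' t" if "t \<in> I" for t
    using that by (blast intro: DERIV_imp_deriv)
  show "twice_differentiable_on f I"
    unfolding twice_differentiable_on_def differentiable_on_eq_differentiable_at[OF I]
    using f deriv_f' real_differentiable_def by blast
qed

lemma solves_XX_on_power2:
  assumes I: "open I" and s: "solves_PII0_on s I" and nz: "\<And>t. t \<in> I \<Longrightarrow> s t \<noteq> 0"
  shows "solves_XX_on (\<lambda>t. (s t)\<^sup>2) I"
proof -
  have s2: "twice_differentiable_on s I"
    and ode: "\<And>t. t \<in> I \<Longrightarrow> deriv (deriv s) t = 2 * s t ^ 3 + t * s t"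
    using s by (auto simp: solves_PII0_on_def)
  note ds [derivative_intros] = twice_differentiable_onD[OF I s2]
  have d1: "((\<lambda>t. (s t)\<^sup>2) has_real_derivative 2 * s t * deriv s t) (at t)" if "t \<in> I" for t
    using that by (auto intro!: derivative_eq_intros)
  have d2: "((\<lambda>t. 2 * s t * deriv s t) has_real_derivative
      2 * (deriv s t)\<^sup>2 + 2 * s t * deriv (deriv s) t) (at t)" if "t \<in> I" for t
    using that by (auto intro!: derivative_eq_intros simp: power2_eq_square algebra_simps)
  note S = twice_differentiable_on_derivs[OF I d1 d2]
  have "2 * (deriv s t)\<^sup>2 + 2 * s t * deriv (deriv s) t =
      (2 * s t * deriv s t)\<^sup>2 / (2 * (s t)\<^sup>2) + 4 * ((s t)\<^sup>2)\<^sup>2 + 2 * t * (s t)\<^sup>2"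
    if "t \<in> I" for t
    using nz[OF that] ode[OF that] by (simp add: field_simps power_numeral_reduce)
  then show ?thesis
    using S nz by (simp add: solves_XX_on_def)
qed

text \<open>
  With \<open>s = \<surd>S\<close> the derivatives are \<open>s' = S' / (2 s)\<close> and
  \<open>s'' = S'' / (2 s) - (S')\<^sup>2 / (4 s\<^sup>3)\<close>. The quadratic term of the equation for \<open>S''\<close>, divided by
  \<open>2 s\<close>, cancels the second summand exactly, leaving \<open>2 s\<^sup>3 + t s\<close>.
\<close>
lemma solves_PII0_on_sqrt:
  assumes I: "open I" and S: "solves_XX_on S I" and pos: "\<And>t. t \<in> I \<Longrightarrow> S t > 0"
  shows "solves_PII0_on (\<lambda>t. sqrt (S t)) I"
proof -
  have S2: "twice_differentiable_on S I"
    and ode: "\<And>t. t \<in> I \<Longrightarrow>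
      deriv (deriv S) t = (deriv S t)\<^sup>2 / (2 * S t) + 4 * (S t)\<^sup>2 + 2 * t * S t"
    using S by (auto simp: solves_XX_on_def)
  note dS [derivative_intros] = twice_differentiable_onD[OF I S2]
  have d1: "((\<lambda>t. sqrt (S t)) has_real_derivative deriv S t / (2 * sqrt (S t))) (at t)"
    if "t \<in> I" for t
    using that pos[OF that] by (auto intro!: derivative_eq_intros simp: field_simps)
  have d2: "((\<lambda>t. deriv S t / (2 * sqrt (S t))) has_real_derivative
      deriv (deriv S) t / (2 * sqrt (S t)) - (deriv S t)\<^sup>2 / (4 * sqrt (S t) ^ 3)) (at t)"
    if "t \<in> I" for t
  proof -
    have "((\<lambda>t. deriv S t / (2 * sqrt (S t))) has_real_derivative
        (deriv (deriv S) t * (2 * sqrt (S t)) - deriv S t * (2 * (deriv S t / (2 * sqrt (S t)))))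
          / (2 * sqrt (S t) * (2 * sqrt (S t)))) (at t)"
      using that pos[OF that] by (intro DERIV_divide DERIV_cmult d1 dS) auto
    moreover have "(a * (2 * r) - b * (2 * (b / (2 * r)))) / (2 * r * (2 * r)) =
        a / (2 * r) - b\<^sup>2 / (4 * r ^ 3)" if "r > 0" for a b r :: real
      using that by (simp add: field_simps power2_eq_square power3_eq_cube)
    ultimately show ?thesis
      using pos[OF that] by (simp only: real_sqrt_gt_zero)
  qed
  note s = twice_differentiable_on_derivs[OF I d1 d2]
  have "deriv (deriv S) t / (2 * sqrt (S t)) - (deriv S t)\<^sup>2 / (4 * sqrt (S t) ^ 3) =
      2 * sqrt (S t) ^ 3 + t * sqrt (S t)" if "t \<in> I" for t
  proof -
    \<comment> \<open>Writing \<open>S\<close> as a square leaves a rational identity without radicals.\<close>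
    define r where "r = sqrt (S t)"
    have "r > 0" and r: "S t = r\<^sup>2"
      using pos[OF that] by (simp_all add: r_def)
    then show ?thesis
      unfolding r_def[symmetric] ode[OF that] r
      by (simp add: field_simps power_numeral_reduce)
  qed
  then show ?thesis
    using s by (simp add: solves_PII0_on_def)
qed

theorem theorem3:
  fixes I :: "real set"
  assumes "open I" and "is_interval I"
  shows "(\<forall>s :: real \<Rightarrow> real.
            solves_PII0_on s I \<longrightarrow> (\<forall>t\<in>I. s t \<noteq> 0) \<longrightarrow> solves_XX_on (\<lambda>t. (s t)\<^sup>2) I) \<and>
         (\<forall>S :: real \<Rightarrow> real.
            solves_XX_on S I \<longrightarrow> (\<forall>t\<in>I. S t > 0) \<longrightarrow> solves_PII0_on (\<lambda>t. sqrt (S t)) I)"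
  using solves_XX_on_power2[OF assms(1)] solves_PII0_on_sqrt[OF assms(1)] by blast

end
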